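(* Let $\varphi_1>0$ and let $f \in C[\varphi_1,\infty)$ be a real-valued function with $\lim_{\varphi\to\infty} f(\varphi)=0$. Assume that there exist positive constants $\underline{m}$, $\overline{a}$, $M$ and $\alpha \in(0,1)$ such that, for all $\varphi \ge \varphi_1$, $$\underline{m}\, \varphi^{-\alpha} \le f(\varphi),$$ $$0 < f(\varphi) - f(\varphi+2\pi) \le \overline{a}\, \varphi^{-\alpha-1},$$ $$\mathrm{length}(\Gamma(\varphi_1,\varphi)) \le M \varphi^{1-\alpha}.$$ Let $\Gamma = \{ (f(\varphi)\cos \varphi,f(\varphi)\sin \varphi) : \varphi \ge \varphi_1 \}$ be the graph of $r=f(\varphi)$ in polar coordinates. Then $\dim_{\rm B} \Gamma = \dfrac{2}{1+\alpha}$.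
   Context: For $\psi_1<\psi_2$, $\Gamma(\psi_1,\psi_2) = \{ (f(\varphi)\cos\varphi,f(\varphi)\sin\varphi) : \psi_1 \le \varphi < \psi_2 \}$, and $\mathrm{length}$ denotes the usual length of a curve (supremum of lengths of inscribed polygonal lines). For a bounded set $\Gamma\subset\mathbf{R}^2$, the box-counting (Minkowski-Bouligand) dimension is $$\dim_{\rm B} \Gamma = 2 - \lim_{\varepsilon \to +0} \frac{\log|\Gamma_\varepsilon|}{\log \varepsilon},$$ where $\Gamma_\varepsilon = \{ (x,y) \in \mathbf{R}^2 : d((x,y),\Gamma) \le \varepsilon \}$, $d$ is the Euclidean distance, and $|\Gamma_\varepsilon|$ is the two-dimensional Lebesgue measure of $\Gamma_\varepsilon$. The assertion $\dim_{\rm B}\Gamma=d$ includes that the limit exists. *)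

theory Defs
  imports "HOL-Analysis.Analysis"
begin

definition polar_curve :: "(real \<Rightarrow> real) \<Rightarrow> real \<Rightarrow> real \<times> real" where
  "polar_curve f \<phi> = (f \<phi> * cos \<phi>, f \<phi> * sin \<phi>)"

text \<open>
  The length of the curve \<open>c\<close> with parameter set \<open>S\<close>: the supremum of the lengths of the polygonal
  lines with vertices \<open>c (t 0), \<dots>, c (t n)\<close>, where \<open>t 0 \<le> \<dots> \<le> t n\<close> lie in \<open>S\<close>.
  The value lies in \<open>[0, \<infinity>]\<close>; it is \<open>0\<close> for an empty \<open>S\<close>.
\<close>

definition curve_length :: "(real \<Rightarrow> 'a::metric_space) \<Rightarrow> real set \<Rightarrow> ennreal" where
  "curve_length c S =
     (SUP (n, t) \<in> {(n :: nat, t :: nat \<Rightarrow> real). (\<forall>i\<le>n. t i \<in> S) \<and> (\<forall>i<n. t i \<le> t (Suc i))}.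
        ennreal (\<Sum>i<n. dist (c (t i)) (c (t (Suc i)))))"

text \<open>
  The product type carries the Euclidean distance. Since \<open>infdist x {} = 0\<close> in the library, this
  set is the whole plane for an empty \<open>A\<close>.
\<close>

definition parallel_set :: "(real \<times> real) set \<Rightarrow> real \<Rightarrow> (real \<times> real) set" where
  "parallel_set A \<epsilon> = {p. infdist p A \<le> \<epsilon>}"

text \<open>
  The box-counting (Minkowski--Bouligand) dimension of \<open>A\<close> exists and equals \<open>d\<close>. The dimension is
  only defined for bounded sets. The empty set is excluded, because there the conventions
  \<open>infdist x {} = 0\<close> and \<open>ln 0 = 0\<close> would give a meaningless value.
\<close>

definition has_box_dimension :: "(real \<times> real) set \<Rightarrow> real \<Rightarrow> bool" where
  "has_box_dimension A d \<longleftrightarrow>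
     A \<noteq> {} \<and> bounded A \<and>
     (\<exists>L. ((\<lambda>\<epsilon>. ln (measure lebesgue (parallel_set A \<epsilon>)) / ln \<epsilon>) \<longlongrightarrow> L) (at_right 0) \<and> d = 2 - L)"

end

theory Submission
  imports Defs
begin

text \<open>
  Parametrize the scale as \<open>\<epsilon> = a * x powr (- \<alpha> - 1)\<close>. Beyond the angle \<open>x\<close> consecutive turns are at
  distance at most \<open>\<epsilon>\<close> on every ray, so the \<open>\<epsilon>\<close>-neighbourhood contains a disc of radius of order
  \<open>x powr - \<alpha>\<close>. Conversely, the telescoping of the increments gives \<open>f x \<le> B * x powr - \<alpha>\<close>, so the
  part beyond \<open>x\<close> lies in a disc of radius of this order, while the part before \<open>x\<close>, of length
  \<open>L \<le> M * x powr (1 - \<alpha>)\<close>, is covered by at most \<open>L / \<epsilon> + 1\<close> discs of radius \<open>\<epsilon>\<close>. Both estimates make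
  the area comparable to \<open>x powr (- 2 * \<alpha>)\<close>, that is, to \<open>\<epsilon> powr (2 * \<alpha> / (1 + \<alpha>))\<close>.
\<close>

section \<open>Polar coordinates and points on a common ray\<close>

lemma norm_polar_curve: "norm (polar_curve f x) = \<bar>f x\<bar>"
proof -
  have "(f x * cos x)\<^sup>2 + (f x * sin x)\<^sup>2 = (f x)\<^sup>2"
    using sin_cos_squared_add2[of x] by (simp add: power_mult_distrib flip: distrib_left)
  then show ?thesis
    by (simp add: polar_curve_def norm_Pair)
qed

lemma polar_curve_shift:
  "polar_curve f (x + 2 * pi * real k) = (f (x + 2 * pi * real k) * cos x, f (x + 2 * pi * real k) * sin x)"
proof -
  have "cos (2 * pi * real k) = 1" "sin (2 * pi * real k) = 0"
    by (metis cos_int_2pin of_int_of_nat_eq, metis sin_int_2pin of_int_of_nat_eq)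
  then show ?thesis by (simp add: polar_curve_def cos_add sin_add)
qed

lemma dist_same_ray: "dist (r * cos t, r * sin t) (s * cos t, s * sin t) = \<bar>r - s\<bar>" for r s t :: real
proof -
  have "(r * cos t - s * cos t)\<^sup>2 + (r * sin t - s * sin t)\<^sup>2 = (r - s)\<^sup>2 * ((sin t)\<^sup>2 + (cos t)\<^sup>2)"
    by algebra
  then show ?thesis
    by (simp add: dist_Pair_Pair dist_real_def)
qed

text \<open>The starting angle \<open>x\<close> is free, so that a point of the plane can be matched
  with a turn of the spiral lying beyond any prescribed angle.\<close>

lemma polar_coordinates_at_angle:
  fixes p :: "real \<times> real" and x :: real
  obtains t where "x \<le> t" "t \<le> x + 2 * pi" "p = (norm p * cos t, norm p * sin t)"
proof -
  obtain u v where p: "p = (u, v)" by force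
  obtain s where s: "p = (norm p * cos s, norm p * sin s)"
  proof (cases "p = 0")
    case True
    then show ?thesis using that[of 0] by (simp add: zero_prod_def)
  next
    case False
    have "(u / norm p)\<^sup>2 + (v / norm p)\<^sup>2 = 1"
      using False by (simp add: p norm_Pair power_divide flip: add_divide_distrib)
        (simp add: zero_prod_def sum_power2_eq_zero_iff)
    then obtain s where "u / norm p = cos s" "v / norm p = sin s"
      using sincos_total_2pi by metis
    then show ?thesis using that[of s] False p by (simp add: field_simps)
  qed
  \<comment> \<open>The least number of full turns, possibly negative, that carries \<open>s\<close>
    to \<open>x\<close> or beyond; it overshoots by less than one turn.\<close>
  define k where "k = \<lceil>(x - s) / (2 * pi)\<rceil>"
  have "(x - s) / (2 * pi) \<le> of_int k" "of_int k < (x - s) / (2 * pi) + 1"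
    unfolding k_def by linarith+
  then have "x \<le> s + 2 * pi * of_int k" "s + 2 * pi * of_int k \<le> x + 2 * pi"
    by (simp_all add: field_simps)
  moreover have "cos (s + 2 * pi * of_int k) = cos s" "sin (s + 2 * pi * of_int k) = sin s"
    by (simp_all add: cos_add sin_add)
  ultimately show ?thesis
    using that s by metis
qed

section \<open>Covering a curve of finite length by balls\<close>

text \<open>Joining the points of \<open>T\<close> in the order of their parameters gives an
  inscribed polygonal line with \<open>card T - 1\<close> edges, each of length at least
  \<open>e\<close>. The extra \<open>e\<close> on the right pays for the missing edge.\<close>

lemma card_separated_le_curve_length:
  fixes c :: "real \<Rightarrow> 'a::metric_space"
  assumes len: "curve_length c S \<le> ennreal L" and L: "0 \<le> L" and e: "0 < e"
    and T: "finite T" "T \<subseteq> c ` S" "\<And>x y. x \<in> T \<Longrightarrow> y \<in> T \<Longrightarrow> x \<noteq> y \<Longrightarrow> e \<le> dist x y"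
  shows "real (card T) * e \<le> L + e"
proof (cases "T = {}")
  case True
  then show ?thesis using L e by simp
next
  case False
  \<comment> \<open>One parameter per point, so that distinct parameters give distinct, hence
    separated, points.\<close>
  obtain U where U: "U \<subseteq> S" "inj_on c U" "T = c ` U"
    using T(2) by (meson subset_image_inj)
  have fU: "finite U" using T(1) U by (metis finite_imageD)
  define xs where "xs = sorted_list_of_set U"
  define n where "n = card U - 1"
  have len_xs: "length xs = Suc n"
    using False U(3) fU card_gt_0_iff[of U] by (simp add: xs_def n_def)
  have set_xs: "set xs = U" "sorted xs" "distinct xs" using fU by (simp_all add: xs_def)
  have inU: "xs ! i \<in> U" if "i \<le> n" for i
    using that len_xs set_xs(1) by (metis le_imp_less_Suc nth_mem)
  have mono: "xs ! i \<le> xs ! Suc i" if "i < n" for i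
    using that len_xs set_xs(2) by (simp add: sorted_iff_nth_mono)
  have sep: "e \<le> dist (c (xs ! i)) (c (xs ! Suc i))" if "i < n" for i
  proof -
    have "xs ! i \<noteq> xs ! Suc i"
      using that len_xs set_xs(3) by (simp add: nth_eq_iff_index_eq)
    then show ?thesis
      using inU[of i] inU[of "Suc i"] that U(2,3) by (intro T(3)) (auto dest: inj_onD)
  qed
  have "real n * e = (\<Sum>i<n. e)" by simp
  also have "\<dots> \<le> (\<Sum>i<n. dist (c (xs ! i)) (c (xs ! Suc i)))"
    using sep by (intro sum_mono) auto
  also have "\<dots> \<le> L"
  proof -
    have "ennreal (\<Sum>i<n. dist (c (xs ! i)) (c (xs ! Suc i))) \<le> curve_length c S"
      unfolding curve_length_def
      using inU U(1) mono by (intro SUP_upper2[of "(n, \<lambda>i. xs ! i)"]) auto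
    then show ?thesis using len L by (meson ennreal_le_iff order_trans)
  qed
  finally have "real n * e \<le> L" .
  moreover have "card T = Suc n"
    using card_image[OF U(2)] U(3) len_xs fU by (simp add: xs_def)
  ultimately show ?thesis by (simp add: algebra_simps)
qed

text \<open>A separated set that cannot be enlarged is a net: a point of the curve outside all the
  balls could be added to it.\<close>

lemma curve_length_cover:
  fixes c :: "real \<Rightarrow> 'a::metric_space"
  assumes len: "curve_length c S \<le> ennreal L" and L: "0 \<le> L" and e: "0 < e"
  obtains T where "finite T" "real (card T) * e \<le> L + e" "c ` S \<subseteq> (\<Union>t\<in>T. ball t e)"
proof -
  define P where "P = (\<lambda>T. finite T \<and> T \<subseteq> c ` S \<and> (\<forall>x\<in>T. \<forall>y\<in>T. x \<noteq> y \<longrightarrow> e \<le> dist x y))"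
  have bound: "real (card T) * e \<le> L + e" if "P T" for T
    using that card_separated_le_curve_length[OF len L e, of T] by (auto simp: P_def)
  \<comment> \<open>Separated sets have uniformly bounded cardinality, so a largest one
    exists.\<close>
  have "card T < Suc (nat \<lfloor>(L + e) / e\<rfloor>)" if "P T" for T
  proof -
    have "real (card T) \<le> (L + e) / e"
      using bound[OF that] e by (simp add: field_simps)
    then show ?thesis by (simp add: le_nat_floor less_Suc_eq_le)
  qed
  moreover have "P {}" by (simp add: P_def)
  \<comment> \<open>a maximal \<open>e\<close>-separated subset of the curve\<close>
  ultimately obtain T where T: "P T" and max: "\<And>T'. P T' \<Longrightarrow> card T' \<le> card T"
    using ex_has_greatest_nat[of P "{}" card] by (metis less_imp_le)
  have "x \<in> (\<Union>t\<in>T. ball t e)" if x: "x \<in> c ` S" for x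
  proof (rule ccontr)
    assume "x \<notin> (\<Union>t\<in>T. ball t e)"
    then have far: "e \<le> dist x t" if "t \<in> T" for t
      using that by (force simp: dist_commute)
    then have "x \<notin> T" using e by force
    moreover have "P (insert x T)"
      using T far x by (auto simp: P_def dist_commute)
    ultimately show False using max[of "insert x T"] T by (simp add: P_def)
  qed
  then have "c ` S \<subseteq> (\<Union>t\<in>T. ball t e)" by blast
  moreover have "finite T" using T by (simp add: P_def)
  ultimately show ?thesis using that bound[OF T] by blast
qed

section \<open>Parallel sets and areas of discs\<close>

lemma closed_parallel_set: "closed (parallel_set A e)"
  unfolding parallel_set_def by (intro closed_Collect_le continuous_intros)

text \<open>The infimum defining \<open>infdist\<close> need not be attained, since \<open>A\<close>
  need not be closed; the factor 2 leaves room for a genuine nearby point.\<close>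

lemma parallel_set_witness:
  assumes "p \<in> parallel_set A e" "A \<noteq> {}" "0 < e"
  obtains q where "q \<in> A" "dist p q < 2 * e"
proof -
  have "infdist p A < 2 * e" using assms by (simp add: parallel_set_def)
  then show ?thesis
    using that assms(2) by (auto simp: infdist_def cINF_less_iff)
qed

lemma content_cball_plane:
  fixes x :: "real \<times> real"
  assumes "0 \<le> r"
  shows "measure lborel (cball x r) = pi * r\<^sup>2"
  using content_cball[OF assms, of x] by (simp add: unit_ball_vol_2 power2_eq_square)

section \<open>Decay of the radius\<close>

text \<open>Along \<open>x + p * k\<close> the difference \<open>B * y powr - \<alpha> - f y\<close>
  does not increase and tends to 0, so it is nonnegative at the start.\<close>

lemma decay_from_increment_bound:
  fixes f :: "real \<Rightarrow> real"
  assumes x1: "0 < x1" and a: "0 < a" and \<alpha>: "0 < \<alpha>" and p: "0 < p"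
    and lim: "(f \<longlongrightarrow> 0) at_top"
    and inc: "\<And>x. x1 \<le> x \<Longrightarrow> f x - f (x + p) \<le> a * x powr (- \<alpha> - 1)"
  obtains B where "0 < B" "\<And>x. x1 \<le> x \<Longrightarrow> f x \<le> B * x powr - \<alpha>"
proof -
  \<comment> \<open>\<open>q\<close> makes \<open>x + p \<le> q * x\<close> for all
    \<open>x \<ge> x1\<close>, so the intermediate point of the mean value theorem is comparable
    with \<open>x\<close>.\<close>
  define q where "q = 1 + p / x1"
  \<comment> \<open>chosen such that \<open>\<lambda>x. B * x powr - \<alpha>\<close> drops by at least \<open>a * x powr (- \<alpha> - 1)\<close> over one period\<close>
  define B where "B = a / (p * \<alpha> * q powr (- \<alpha> - 1))"
  have q: "0 < q" using x1 p by (simp add: q_def add_pos_pos)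
  have B: "0 < B" using a p \<alpha> q by (simp add: B_def)
  have drop: "a * x powr (- \<alpha> - 1) \<le> B * x powr - \<alpha> - B * (x + p) powr - \<alpha>" if x: "x1 \<le> x" for x
  proof -
    have "\<exists>z. x < z \<and> z < x + p \<and>
        (x + p) powr - \<alpha> - x powr - \<alpha> = (x + p - x) * (- \<alpha> * z powr (- \<alpha> - 1))"
      using x x1 p by (intro MVT2) (auto intro!: derivative_eq_intros simp: powr_diff)
    then obtain z where z: "x < z" "z < x + p"
      "x powr - \<alpha> - (x + p) powr - \<alpha> = p * \<alpha> * z powr (- \<alpha> - 1)"
      by (auto simp: algebra_simps)
    have "z \<le> q * x"
    proof -
      have "p \<le> p / x1 * x" using x x1 p by (simp add: field_simps)
      then show ?thesis using z by (simp add: q_def algebra_simps)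
    qed
    then have "(q * x) powr (- \<alpha> - 1) \<le> z powr (- \<alpha> - 1)"
      using z x x1 \<alpha> by (intro powr_mono2') auto
    then have "B * (p * \<alpha> * (q * x) powr (- \<alpha> - 1)) \<le> B * (p * \<alpha> * z powr (- \<alpha> - 1))"
      using B p \<alpha> by (intro mult_left_mono) auto
    moreover have "B * (p * \<alpha> * (q * x) powr (- \<alpha> - 1)) = a * x powr (- \<alpha> - 1)"
      using q x x1 p \<alpha> by (simp add: B_def powr_mult)
    ultimately show ?thesis using z(3) by (simp flip: right_diff_distrib)
  qed
  have "f x \<le> B * x powr - \<alpha>" if x: "x1 \<le> x" for x
  proof -
    define h where "h = (\<lambda>y. B * y powr - \<alpha> - f y)"
    have x_k: "x1 \<le> x + p * real k" for k using x p by (simp add: add_increasing2)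
    have "h (x + p * real (Suc k)) \<le> h (x + p * real k)" for k
    proof -
      have "x + p * real (Suc k) = x + p * real k + p" by (simp add: algebra_simps)
      then show ?thesis
        using drop[OF x_k[of k]] inc[OF x_k[of k]] by (simp add: h_def algebra_simps)
    qed
    then have "decseq (\<lambda>k. h (x + p * real k))" by (intro decseq_SucI)
    moreover have "(\<lambda>k. h (x + p * real k)) \<longlonglongrightarrow> 0"
    proof -
      have "((\<lambda>y. y powr - \<alpha>) \<longlongrightarrow> 0) at_top"
        using \<alpha> by (intro tendsto_neg_powr filterlim_ident) auto
      from tendsto_diff[OF tendsto_mult_left[OF this, of B] lim]
      have "(h \<longlongrightarrow> 0) at_top" by (simp add: h_def)
      moreover have "filterlim (\<lambda>k. x + p * real k) at_top sequentially"
        using p by (intro filterlim_tendsto_add_at_top[OF tendsto_const]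
            filterlim_tendsto_pos_mult_at_top[OF tendsto_const] filterlim_real_sequentially)
      ultimately show ?thesis by (rule filterlim_compose)
    qed
    ultimately have "0 \<le> h (x + p * real 0)" by (rule decseq_ge)
    then show ?thesis by (simp add: h_def)
  qed
  then show ?thesis using that B by blast
qed

section \<open>Lower and upper area bounds\<close>

text \<open>On the ray through a point \<open>p\<close> of the disc, the radii of successive turns
  start at or above \<open>norm p\<close>, drop by at most \<open>e\<close> per turn and tend to 0.
  The first one below \<open>norm p + e\<close> is therefore within \<open>e\<close> of
  \<open>norm p\<close>.\<close>

lemma cball_subset_parallel_spiral:
  fixes f :: "real \<Rightarrow> real"
  assumes "0 < m" "0 < \<alpha>" "0 < x" "0 < e"
    and lim: "(f \<longlongrightarrow> 0) at_top"
    and lower: "\<And>y. x \<le> y \<Longrightarrow> m * y powr (- \<alpha>) \<le> f y"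
    and inc: "\<And>y. x \<le> y \<Longrightarrow> f y - f (y + 2 * pi) \<le> e"
  shows "cball 0 (m * (x + 2 * pi) powr - \<alpha>) \<subseteq> parallel_set (polar_curve f ` {x..}) e"
proof
  fix p :: "real \<times> real"
  assume p: "p \<in> cball 0 (m * (x + 2 * pi) powr - \<alpha>)"
  obtain t where t: "x \<le> t" "t \<le> x + 2 * pi" "p = (norm p * cos t, norm p * sin t)"
    by (rule polar_coordinates_at_angle)
  define r where "r = norm p"
  define y where "y = (\<lambda>k. t + 2 * pi * real k)"
  have y: "x \<le> y k" for k using t(1) by (simp add: y_def add_increasing2)
  have "r \<le> m * t powr - \<alpha>"
  proof -
    \<comment> \<open>The radius of the disc is the lower bound for \<open>f\<close> at the last
      angle \<open>x + 2 * pi\<close> of the first turn, hence the smallest over that turn.\<close>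
    have "m * (x + 2 * pi) powr - \<alpha> \<le> m * t powr - \<alpha>"
      using assms t by (intro mult_left_mono powr_mono2') auto
    then show ?thesis using p by (simp add: r_def)
  qed
  then have ft: "r \<le> f t" using lower[OF t(1)] by linarith
  have "filterlim y at_top sequentially"
    unfolding y_def by (intro filterlim_tendsto_add_at_top[OF tendsto_const]
        filterlim_tendsto_pos_mult_at_top[OF tendsto_const] filterlim_real_sequentially) simp
  then have "(\<lambda>k. f (y k)) \<longlonglongrightarrow> 0" by (rule filterlim_compose[OF lim])
  moreover have "0 < r + e" using assms by (simp add: r_def add_nonneg_pos)
  ultimately have "\<forall>\<^sub>F k in sequentially. f (y k) < r + e" by (rule order_tendstoD)
  then have ex: "\<exists>k. f (y k) < r + e" by (auto dest: eventually_happens)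
  \<comment> \<open>The offset \<open>e\<close> makes the first turn (\<open>k = 0\<close>, where \<open>r \<le> f t\<close>) and the point \<open>r = 0\<close> unexceptional.\<close>
  define k where "k = (LEAST k. f (y k) < r + e)"
  have k: "f (y k) < r + e" unfolding k_def by (rule LeastI_ex[OF ex])
  have "r \<le> f (y k)"
  proof (cases k)
    case 0
    then show ?thesis using ft by (simp add: y_def)
  next
    case (Suc j)
    then have "r + e \<le> f (y j)"
      using not_less_Least[of j "\<lambda>k. f (y k) < r + e"] by (simp add: k_def)
    moreover have "y k = y j + 2 * pi" by (simp add: Suc y_def algebra_simps)
    ultimately show ?thesis using inc[OF y[of j]] by simp
  qed
  then have "dist p (polar_curve f (y k)) \<le> e"
    using k t(3) dist_same_ray[of r t "f (y k)"] by (simp add: y_def polar_curve_shift r_def)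
  moreover have "polar_curve f (y k) \<in> polar_curve f ` {x..}" using y by auto
  ultimately show "p \<in> parallel_set (polar_curve f ` {x..}) e"
    unfolding parallel_set_def by (blast intro: infdist_le order_trans)
qed

lemma parallel_set_mono:
  assumes "A \<subseteq> B" "A \<noteq> {}"
  shows "parallel_set A e \<subseteq> parallel_set B e"
  unfolding parallel_set_def using infdist_mono[OF assms] by (auto intro: order_trans)

lemma lmeasurable_parallel_set:
  assumes "bounded A" "A \<noteq> {}" "0 < e"
  shows "parallel_set A e \<in> lmeasurable"
proof -
  obtain R where R: "\<And>x. x \<in> A \<Longrightarrow> norm x \<le> R" using assms(1) by (auto simp: bounded_iff)
  have "norm p \<le> R + 2 * e" if p: "p \<in> parallel_set A e" for p
  proof -
    obtain q where q: "q \<in> A" "dist p q < 2 * e"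
      using parallel_set_witness[OF p assms(2,3)] .
    then show ?thesis using R[OF q(1)] norm_triangle_sub[of p q] by (simp add: dist_norm)
  qed
  then have "bounded (parallel_set A e)" unfolding bounded_iff by blast
  then show ?thesis
    using closed_parallel_set by (intro lmeasurable_compact) (simp add: compact_eq_bounded_closed)
qed

text \<open>A net of the part over \<open>S\<close> gives discs of radius \<open>3 * e\<close>: one
  \<open>e\<close> for the net and \<open>2 * e\<close> for the parallel set. Their total area is
  \<open>9 * pi * e\<close> times \<open>card T * e\<close>, which the length controls; one disc
  serves the part over \<open>S'\<close>.\<close>

lemma measure_parallel_curve_le:
  fixes c :: "real \<Rightarrow> real \<times> real"
  assumes len: "curve_length c S \<le> ennreal L" and L: "0 \<le> L" and e: "0 < e" and R: "0 \<le> R"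
    and tail: "\<And>t. t \<in> S' \<Longrightarrow> norm (c t) \<le> R" and ne: "S \<union> S' \<noteq> {}"
    and meas: "parallel_set (c ` (S \<union> S')) e \<in> lmeasurable"
  shows "measure lebesgue (parallel_set (c ` (S \<union> S')) e) \<le> pi * (R + 2 * e)\<^sup>2 + 9 * pi * e * (L + e)"
proof -
  obtain T where T: "finite T" "real (card T) * e \<le> L + e" "c ` S \<subseteq> (\<Union>t\<in>T. ball t e)"
    using curve_length_cover[OF len L e] .
  let ?U = "cball 0 (R + 2 * e) \<union> (\<Union>t\<in>T. cball t (3 * e))"
  have sub: "parallel_set (c ` (S \<union> S')) e \<subseteq> ?U"
  proof
    fix p assume p: "p \<in> parallel_set (c ` (S \<union> S')) e"
    have "c ` (S \<union> S') \<noteq> {}" using ne by simp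
    then obtain q where "q \<in> c ` (S \<union> S')" "dist p q < 2 * e"
      using parallel_set_witness[OF p _ e] by blast
    then obtain s where s: "s \<in> S \<union> S'" "dist p (c s) < 2 * e" by blast
    show "p \<in> ?U"
    proof (cases "s \<in> S")
      case True
      then obtain t where "t \<in> T" "dist t (c s) < e" using T(3) by auto
      then have "p \<in> cball t (3 * e)"
        using s(2) dist_triangle[of t p "c s"] by (simp add: dist_commute)
      then show ?thesis using \<open>t \<in> T\<close> by blast
    next
      case False
      then have "norm (c s) \<le> R" using s(1) tail by blast
      then show ?thesis
        using s(2) norm_triangle_sub[of p "c s"] by (simp add: dist_norm)
    qed
  qed
  have "measure lebesgue (parallel_set (c ` (S \<union> S')) e) \<le> measure lebesgue ?U"
    using T(1) meas by (intro measure_mono_fmeasurable[OF sub])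
       (auto intro!: fmeasurable.Un fmeasurable.finite_UN lmeasurable_cball)
  also have "\<dots> \<le> measure lebesgue (cball (0::real \<times> real) (R + 2 * e))
      + measure lebesgue (\<Union>t\<in>T. cball t (3 * e))"
    using T(1) by (intro measure_Un_le) (auto intro!: sets.finite_UN)
  also have "measure lebesgue (\<Union>t\<in>T. cball t (3 * e)) \<le> (\<Sum>t\<in>T. measure lebesgue (cball t (3 * e)))"
    using T(1) by (intro measure_UNION_le) auto
  also have "(\<Sum>t\<in>T. measure lebesgue (cball t (3 * e))) = 9 * pi * e * (real (card T) * e)"
    using e by (simp add: content_cball_plane power2_eq_square)
  also have "9 * pi * e * (real (card T) * e) \<le> 9 * pi * e * (L + e)"
    using T(2) e by (intro mult_left_mono) auto
  finally show ?thesis using e R by (simp add: content_cball_plane)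
qed

section \<open>From area bounds to the dimension\<close>

text \<open>After taking logarithms a constant factor \<open>k\<close> contributes only
  \<open>ln k / ln e\<close>, which vanishes as \<open>e\<close> tends to 0.\<close>

lemma tendsto_log_ratio_of_power_bounds:
  fixes V :: "real \<Rightarrow> real"
  assumes c: "0 < c" and C: "0 < C"
    and V: "\<forall>\<^sub>F e in at_right 0. c * e powr b \<le> V e \<and> V e \<le> C * e powr b"
  shows "((\<lambda>e. ln (V e) / ln e) \<longlongrightarrow> b) (at_right 0)"
proof -
  have lim: "((\<lambda>e. ln k / ln e + b) \<longlongrightarrow> b) (at_right 0)" for k :: real
  proof -
    have "((\<lambda>e. ln k / ln e) \<longlongrightarrow> 0) (at_right 0)"
      by (intro tendsto_divide_0[OF tendsto_const] filterlim_at_bot_imp_at_infinity ln_at_0)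
    then show ?thesis using tendsto_add[OF _ tendsto_const[of b]] by fastforce
  qed
  have small: "\<forall>\<^sub>F e in at_right (0::real). 0 < e \<and> e < 1"
    using eventually_at_right_real[of 0 1] by simp
  have "\<forall>\<^sub>F e in at_right 0. ln C / ln e + b \<le> ln (V e) / ln e \<and> ln (V e) / ln e \<le> ln c / ln e + b"
    using V small
  proof eventually_elim
    case (elim e)
    have pos: "0 < c * e powr b" using c elim by simp
    have ne: "ln e < 0" using elim by simp
    have "ln (c * e powr b) \<le> ln (V e)" "ln (V e) \<le> ln (C * e powr b)"
      using pos elim by (auto simp del: ln_le_cancel_iff intro!: ln_mono)
    then have "ln c + b * ln e \<le> ln (V e)" "ln (V e) \<le> ln C + b * ln e"
      using c C elim by (simp_all add: ln_mult ln_powr)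
    \<comment> \<open>Division by the negative number \<open>ln e\<close> interchanges the upper and
      the lower bound.\<close>
    then have "(ln C + b * ln e) / ln e \<le> ln (V e) / ln e" "ln (V e) / ln e \<le> (ln c + b * ln e) / ln e"
      using ne by (auto intro: divide_right_mono_neg)
    then show ?case using ne by (simp add: add_divide_distrib)
  qed
  then show ?thesis
    by (intro tendsto_sandwich[OF _ _ lim[of C] lim[of c]]) (auto elim: eventually_mono)
qed

theorem theorem1p3:
  fixes f :: "real \<Rightarrow> real" and \<phi>\<^sub>1 m a M \<alpha> :: real
  assumes "\<phi>\<^sub>1 > 0"
    and "continuous_on {\<phi>\<^sub>1..} f"
    and "(f \<longlongrightarrow> 0) at_top"
    and "m > 0" and "a > 0" and "M > 0"
    and "0 < \<alpha>" and "\<alpha> < 1"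
    and "\<And>\<phi>. \<phi> \<ge> \<phi>\<^sub>1 \<Longrightarrow> m * \<phi> powr (- \<alpha>) \<le> f \<phi>"
    and "\<And>\<phi>. \<phi> \<ge> \<phi>\<^sub>1 \<Longrightarrow> 0 < f \<phi> - f (\<phi> + 2 * pi)"
    and "\<And>\<phi>. \<phi> \<ge> \<phi>\<^sub>1 \<Longrightarrow> f \<phi> - f (\<phi> + 2 * pi) \<le> a * \<phi> powr (- \<alpha> - 1)"
    and "\<And>\<phi>. \<phi> \<ge> \<phi>\<^sub>1 \<Longrightarrow>
           curve_length (polar_curve f) {\<phi>\<^sub>1..<\<phi>} \<le> ennreal (M * \<phi> powr (1 - \<alpha>))"
  shows "has_box_dimension (polar_curve f ` {\<phi>\<^sub>1..}) (2 / (1 + \<alpha>))"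
proof -
  note lower = assms(9) and inc = assms(11) and len = assms(12)
  let ?\<Gamma> = "polar_curve f ` {\<phi>\<^sub>1..}"
  let ?V = "\<lambda>e. measure lebesgue (parallel_set ?\<Gamma> e)"
  obtain B where B: "0 < B" "\<And>x. \<phi>\<^sub>1 \<le> x \<Longrightarrow> f x \<le> B * x powr - \<alpha>"
    using decay_from_increment_bound[OF assms(1,5,7) _ assms(3) inc] by auto
  have norm_le: "norm (polar_curve f y) \<le> B * x powr - \<alpha>" if "\<phi>\<^sub>1 \<le> x" "x \<le> y" for x y
  proof -
    have "0 \<le> f y" using lower[of y] that assms(4) by (smt (verit) mult_nonneg_nonneg powr_ge_zero)
    moreover have "y powr - \<alpha> \<le> x powr - \<alpha>" using that assms(1,7) by (intro powr_mono2') auto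
    then have "B * y powr - \<alpha> \<le> B * x powr - \<alpha>" using B(1) by simp
    ultimately show ?thesis using B(2)[of y] that by (simp add: norm_polar_curve)
  qed
  have bdd: "bounded ?\<Gamma>" using norm_le[of "\<phi>\<^sub>1"] by (auto simp: bounded_iff)
  have ne: "?\<Gamma> \<noteq> {}" by simp
  \<comment> \<open>\<open>b\<close> is the exponent of the area as a power of the scale. The
    constants \<open>c\<close> and \<open>C\<close> are what remains of the inner disc and of the
    covering once \<open>x powr (- 2 * \<alpha>)\<close> is factored out.\<close>
  define b where "b = 2 * \<alpha> / (1 + \<alpha>)"
  define c where "c = pi * (m * 2 powr - \<alpha>)\<^sup>2"
  define C where "C = pi * (B + 2 * a)\<^sup>2 + 9 * pi * a * (M + a)"
  have c: "0 < c" and C: "0 < C"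
    using assms(4-6) B(1) by (simp_all add: c_def C_def add_nonneg_pos)
  have bounds: "c * x powr (- 2 * \<alpha>) \<le> ?V (a * x powr (- \<alpha> - 1))
      \<and> ?V (a * x powr (- \<alpha> - 1)) \<le> C * x powr (- 2 * \<alpha>)"
    if x: "\<phi>\<^sub>1 \<le> x" "2 * pi \<le> x" for x
  proof
    define e where "e = a * x powr (- \<alpha> - 1)"
    have x1: "1 \<le> x" "0 < x" using x pi_gt3 by linarith+
    have e: "0 < e" using assms(5) x1 by (simp add: e_def)
    have sq: "(x powr - \<alpha>)\<^sup>2 = x powr (- 2 * \<alpha>)"
      by (simp add: power2_eq_square flip: powr_add)
    have meas: "parallel_set ?\<Gamma> e \<in> lmeasurable"
      by (rule lmeasurable_parallel_set[OF bdd ne e])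
    \<comment> \<open>\<open>x + 2 * pi \<le> 2 * x\<close> replaces the radius by a pure power of
      \<open>x\<close>; this is the origin of \<open>2 powr - \<alpha>\<close> in
      \<open>c\<close>.\<close>
    have "cball 0 (m * (2 * x) powr - \<alpha>) \<subseteq> cball (0::real \<times> real) (m * (x + 2 * pi) powr - \<alpha>)"
      using x x1 assms(4,7) by (intro subset_cball mult_left_mono powr_mono2') (auto simp: add_pos_pos)
    also have "\<dots> \<subseteq> parallel_set (polar_curve f ` {x..}) e"
    proof (rule cball_subset_parallel_spiral[OF assms(4,7) x1(2) e assms(3)])
      fix y assume y: "x \<le> y"
      show "m * y powr - \<alpha> \<le> f y" using lower x y by simp
      have "a * y powr (- \<alpha> - 1) \<le> e"
        unfolding e_def using y x1 assms(5,7) by (intro mult_left_mono powr_mono2') auto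
      then show "f y - f (y + 2 * pi) \<le> e" using inc[of y] x y by linarith
    qed
    also have "\<dots> \<subseteq> parallel_set ?\<Gamma> e" using x by (intro parallel_set_mono) auto
    finally have "measure lebesgue (cball (0::real \<times> real) (m * (2 * x) powr - \<alpha>)) \<le> ?V e"
      using meas by (intro measure_mono_fmeasurable) auto
    moreover have "measure lebesgue (cball (0::real \<times> real) (m * (2 * x) powr - \<alpha>)) = c * (x powr - \<alpha>)\<^sup>2"
      using assms(4) x1
      by (simp add: content_cball_plane c_def powr_mult power_mult_distrib)
    ultimately show "c * x powr (- 2 * \<alpha>) \<le> ?V (a * x powr (- \<alpha> - 1))"
      by (simp only: sq e_def)
    \<comment> \<open>Up to the angle \<open>x\<close> the length bound is used, beyond it the decay
      of the radius.\<close>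
    have split: "{\<phi>\<^sub>1..} = {\<phi>\<^sub>1..<x} \<union> {x..}" using x by auto
    have "?V e \<le> pi * (B * x powr - \<alpha> + 2 * e)\<^sup>2 + 9 * pi * e * (M * x powr (1 - \<alpha>) + e)"
      unfolding split
    proof (rule measure_parallel_curve_le[OF len[OF x(1)] _ e])
      show "parallel_set (polar_curve f ` ({\<phi>\<^sub>1..<x} \<union> {x..})) e \<in> lmeasurable"
        using meas unfolding split .
    qed (use assms(6) B(1) norm_le[OF x(1)] in auto)
    \<comment> \<open>Since \<open>x \<ge> 1\<close>, the scale \<open>e\<close> is absorbed both by
      the radius of order \<open>x powr - \<alpha>\<close> and by the length of order
      \<open>x powr (1 - \<alpha>)\<close>.\<close>
    also have "\<dots> \<le> pi * ((B + 2 * a) * x powr - \<alpha>)\<^sup>2 + 9 * pi * a * (M + a) * x powr (- 2 * \<alpha>)"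
    proof (intro add_mono mult_left_mono power_mono)
      have "x powr (- \<alpha> - 1) \<le> x powr - \<alpha>" using x1 by (intro powr_mono) auto
      then show "B * x powr - \<alpha> + 2 * e \<le> (B + 2 * a) * x powr - \<alpha>"
        using assms(5) by (simp add: e_def algebra_simps)
      have "x powr (- \<alpha> - 1) \<le> x powr (1 - \<alpha>)" using x1 by (intro powr_mono) auto
      then have "M * x powr (1 - \<alpha>) + e \<le> (M + a) * x powr (1 - \<alpha>)"
        using assms(5) by (simp add: e_def algebra_simps)
      then have "9 * pi * e * (M * x powr (1 - \<alpha>) + e) \<le> 9 * pi * e * ((M + a) * x powr (1 - \<alpha>))"
        using e by (intro mult_left_mono) auto
      also have "\<dots> = 9 * pi * a * (M + a) * (x powr (- \<alpha> - 1) * x powr (1 - \<alpha>))"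
        by (simp add: e_def)
      also have "x powr (- \<alpha> - 1) * x powr (1 - \<alpha>) = x powr (- 2 * \<alpha>)"
        by (simp flip: powr_add)
      finally show "9 * pi * e * (M * x powr (1 - \<alpha>) + e) \<le> 9 * pi * a * (M + a) * x powr (- 2 * \<alpha>)" .
    qed (use e B(1) in auto)
    also have "\<dots> = C * x powr (- 2 * \<alpha>)"
      unfolding power_mult_distrib sq C_def by (simp add: algebra_simps)
    finally show "?V (a * x powr (- \<alpha> - 1)) \<le> C * x powr (- 2 * \<alpha>)" by (simp add: e_def)
  qed
  have "((\<lambda>e. ln (?V e) / ln e) \<longlongrightarrow> b) (at_right 0)"
  proof (rule tendsto_log_ratio_of_power_bounds)
    \<comment> \<open>\<open>X\<close> inverts the scale: \<open>X e\<close> is the angle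
      \<open>x\<close> with \<open>a * x powr (- \<alpha> - 1) = e\<close>.\<close>
    define X where "X = (\<lambda>e. (e / a) powr (- 1 / (1 + \<alpha>)))"
    have X: "a * X e powr (- \<alpha> - 1) = e" "X e powr (- 2 * \<alpha>) = a powr - b * e powr b"
      if "0 < e" for e
    proof -
      have ex: "- 1 / (1 + \<alpha>) * (- \<alpha> - 1) = 1" "- 1 / (1 + \<alpha>) * (- 2 * \<alpha>) = b"
        using assms(7) by (simp_all add: b_def field_simps)
      show "a * X e powr (- \<alpha> - 1) = e" "X e powr (- 2 * \<alpha>) = a powr - b * e powr b"
        unfolding X_def powr_powr ex using that assms(5)
        by (simp_all add: powr_divide powr_minus_divide)
    qed
    define K where "K = max \<phi>\<^sub>1 (2 * pi)"
    have K: "0 < K" using assms(1) by (simp add: K_def less_max_iff_disj)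
    \<comment> \<open>\<open>X\<close> is decreasing and takes the value \<open>K\<close> at
      \<open>a * K powr (- \<alpha> - 1)\<close>, so small scales correspond to angles where
      \<open>bounds\<close> applies.\<close>
    have "K \<le> X e" if "0 < e" "e < a * K powr (- \<alpha> - 1)" for e
    proof -
      have "- 1 / (1 + \<alpha>) * (- \<alpha> - 1) = 1" using assms(7) by (simp add: field_simps)
      then have "K = (K powr (- \<alpha> - 1)) powr (- 1 / (1 + \<alpha>))"
        using K by (simp add: powr_powr mult.commute)
      also have "\<dots> \<le> X e"
        unfolding X_def using that assms(5,7) by (intro powr_mono2') (auto simp: field_simps)
      finally show ?thesis .
    qed
    moreover have "0 < a * K powr (- \<alpha> - 1)" using K assms(5) by simp
    ultimately have "\<forall>\<^sub>F e in at_right 0. K \<le> X e"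
      unfolding eventually_at_right_field by blast
    then show "\<forall>\<^sub>F e in at_right 0. c * a powr - b * e powr b \<le> ?V e \<and> ?V e \<le> C * a powr - b * e powr b"
      using eventually_at_right_less[of "0::real"]
    proof eventually_elim
      case (elim e)
      then show ?case using bounds[of "X e"] X[of e] by (simp add: K_def mult.assoc)
    qed
  qed (use c C assms(5) in auto)
  moreover have "2 / (1 + \<alpha>) = 2 - b" using assms(7) by (simp add: b_def field_simps)
  ultimately show ?thesis
    unfolding has_box_dimension_def using bdd ne by blast
qed

end
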